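(* All the numbers of the form $2^{n-1}\cdot(2m+1)$, where $m$ and $n$ are positive integers such that $2m+1$ is composite and $2m+1>2^n$, are expressed by at least one sum of an odd number of consecutive positive integers and also by at least one sum of an even number of consecutive positive integers.
   Context: A sum of consecutive positive integers is a sum $a+(a+1)+\cdots+(a+r-1)$ with $r\ge 2$ terms, where $a$ is a positive integer; it is a sum of an odd (respectively even) number of consecutive positive integers if $r$ is odd (respectively even). *)

theory Defs
  imports "HOL-Computational_Algebra.Primes"
begin

definition composite :: "nat \<Rightarrow> bool" where
  "composite k \<longleftrightarrow> k > 1 \<and> \<not> prime k"

definition is_consecutive_sum :: "nat \<Rightarrow> nat \<Rightarrow> nat \<Rightarrow> bool" where
  "is_consecutive_sum N a r \<longleftrightarrow> a \<ge> 1 \<and> r \<ge> 2 \<and> N = (\<Sum>i<r. a + i)"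

definition sum_of_odd_number_of_consecutive :: "nat \<Rightarrow> bool" where
  "sum_of_odd_number_of_consecutive N \<longleftrightarrow> (\<exists>a r. odd r \<and> is_consecutive_sum N a r)"

definition sum_of_even_number_of_consecutive :: "nat \<Rightarrow> bool" where
  "sum_of_even_number_of_consecutive N \<longleftrightarrow> (\<exists>a r. even r \<and> is_consecutive_sum N a r)"

end

theory Submission
  imports Defs
begin

text \<open>
  A sum of \<open>r\<close> consecutive integers is \<open>r\<close> times their average, so expressing \<open>N\<close> amounts to
  writing \<open>2 * N\<close> as the product of \<open>r\<close> and the sum of the first and the last term. These two
  factors have opposite parity, and the first term comes out positive exactly when \<open>r\<close> is the
  smaller one. For \<open>N = 2 ^ (n - 1) * M\<close> with \<open>M = 2 * m + 1\<close>, the product is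
  \<open>2 * N = 2 ^ n * M\<close>.

  The hypothesis \<open>2 ^ n < M\<close> makes the even number \<open>r = 2 ^ n\<close> the smaller of the factors
  \<open>2 ^ n\<close> and \<open>M\<close> (\<open>consecutive_sum_two_middle_terms\<close>).
  Compositeness gives \<open>M = r * q\<close> with \<open>1 < r \<le> q\<close>, where \<open>r\<close> is odd because \<open>M\<close> is; the
  average \<open>2 ^ (n - 1) * q\<close> is then an integer, at least \<open>r\<close>, and it can serve as the middle of
  \<open>r\<close> positive consecutive integers (\<open>consecutive_sum_middle_term\<close>).
\<close>

text \<open>Pairing the first term with the last; the summand \<open>r\<close> on the left avoids a truncated
  subtraction on the right.\<close>

lemma double_consecutive_sum:
  fixes a r :: nat
  shows "2 * (\<Sum>i<r. a + i) + r = r * (2 * a + r)"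
  by (induction r) (auto simp: algebra_simps)

lemma consecutive_sum_middle_term:
  fixes c k :: nat
  assumes "k \<ge> 1" and "k < c"
  shows "is_consecutive_sum ((2 * k + 1) * c) (c - k) (2 * k + 1)"
proof -
  obtain a where c: "c = a + k" and a: "a \<ge> 1"
    using assms(2) by (intro that[of "c - k"]) linarith+
  have "2 * (\<Sum>i<2 * k + 1. a + i) + (2 * k + 1) = 2 * ((2 * k + 1) * c) + (2 * k + 1)"
    unfolding double_consecutive_sum c by (simp add: algebra_simps)
  then have "(2 * k + 1) * c = (\<Sum>i<2 * k + 1. a + i)"
    by linarith
  then show ?thesis
    using a assms(1) c by (simp add: is_consecutive_sum_def)
qed

text \<open>With \<open>2 * h\<close> terms there is no middle term, but the two in the middle, \<open>m\<close> and \<open>m + 1\<close>,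
  have the same sum as each of the \<open>h\<close> pairs placed symmetrically about them.\<close>

lemma consecutive_sum_two_middle_terms:
  fixes h m :: nat
  assumes "h \<ge> 1" and "h \<le> m"
  shows "is_consecutive_sum (h * (2 * m + 1)) (m + 1 - h) (2 * h)"
proof -
  obtain b where m: "m = b + h"
    using assms(2) by (metis le_add_diff_inverse2)
  have "2 * (\<Sum>i<2 * h. (b + 1) + i) + 2 * h = 2 * (h * (2 * m + 1)) + 2 * h"
    unfolding double_consecutive_sum m by (simp add: algebra_simps)
  then have "h * (2 * m + 1) = (\<Sum>i<2 * h. (b + 1) + i)"
    by linarith
  then show ?thesis
    using assms(1) m by (simp add: is_consecutive_sum_def)
qed

lemma composite_factors:
  assumes "composite M"
  obtains r q where "M = r * q" and "1 < r" and "r \<le> q"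
proof -
  from assms obtain d where "d dvd M" "d \<noteq> 1" "d \<noteq> M" and M: "M > 1"
    unfolding composite_def prime_nat_iff by blast
  then obtain e where e: "M = d * e"
    by blast
  have "d \<noteq> 0" "e \<noteq> 0" "e \<noteq> 1"
    using e M \<open>d \<noteq> M\<close> by (cases d; cases "e = 0"; cases "e = 1"; simp)+
  with \<open>d \<noteq> 1\<close> have "d > 1" "e > 1"
    by linarith+
  show thesis
  proof (cases "d \<le> e")
    case True
    with e \<open>d > 1\<close> that show thesis by blast
  next
    case False
    with e \<open>e > 1\<close> that[of e d] show thesis by (simp add: mult.commute)
  qed
qed

theorem mainTheorem10:
  fixes m n :: nat
  assumes "m \<ge> 1" and "n \<ge> 1"
    and "composite (2 * m + 1)"
    and "2 * m + 1 > 2 ^ n"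
  shows "sum_of_odd_number_of_consecutive (2 ^ (n - 1) * (2 * m + 1))
       \<and> sum_of_even_number_of_consecutive (2 ^ (n - 1) * (2 * m + 1))"
proof
  define h :: nat where "h = 2 ^ (n - 1)"
  have h: "h \<ge> 1" and double_h: "2 ^ n = 2 * h"
    using assms(2) by (cases n; simp add: h_def)+

  obtain r q where rq: "2 * m + 1 = r * q" "1 < r" "r \<le> q"
    using composite_factors[OF assms(3)] .
  have "odd (r * q)"
    unfolding rq(1)[symmetric] by simp
  then have "odd r"
    by simp
  then obtain k where k: "r = 2 * k + 1"
    by (rule oddE)
  have "q \<le> h * q"
    using h by simp
  then have "k < h * q" "k \<ge> 1"
    using rq k by linarith+
  then have "is_consecutive_sum (r * (h * q)) (h * q - k) r"
    unfolding k by (intro consecutive_sum_middle_term)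
  moreover have "r * (h * q) = h * (2 * m + 1)"
    unfolding rq(1) by simp
  ultimately show "sum_of_odd_number_of_consecutive (2 ^ (n - 1) * (2 * m + 1))"
    unfolding sum_of_odd_number_of_consecutive_def h_def[symmetric] using \<open>odd r\<close> by metis

  have "h \<le> m"
    using assms(4) double_h by linarith
  then have "is_consecutive_sum (h * (2 * m + 1)) (m + 1 - h) (2 * h)"
    using h by (intro consecutive_sum_two_middle_terms)
  then show "sum_of_even_number_of_consecutive (2 ^ (n - 1) * (2 * m + 1))"
    unfolding sum_of_even_number_of_consecutive_def h_def[symmetric]
    using dvd_triv_left by blast
qed

end
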